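(* Let $B$ be a supersoluble brace. Then $(B,+)$ is nilpotent if and only if there is $n\in\mathbb{N}$ such that $B=\operatorname{Soc}_n(B)$.
   Context: A brace (skew left brace) is a set $B$ with two binary operations $+$ and $\cdot$ such that $(B,+)$ and $(B,\cdot)$ are groups and $a(b+c)=ab-a+ac$ for all $a,b,c\in B$. $\lambda_a(b)=-a+ab$ defines a homomorphism $\lambda\colon(B,\cdot)\to\operatorname{Aut}(B,+)$. An ideal is a subset that is a subgroup of both groups, normal in both, and invariant under all $\lambda_b$; quotients by ideals are braces. $\operatorname{Soc}(B)=\operatorname{Ker}\lambda\cap Z(B,+)$ is an ideal. Put $\operatorname{Soc}_0(B)=\{0\}$ and define $\operatorname{Soc}_{k+1}(B)$ by $\operatorname{Soc}_{k+1}(B)/\operatorname{Soc}_k(B)=\operatorname{Soc}(B/\operatorname{Soc}_k(B))$. $B$ is supersoluble if there is a finite chain of ideals $\{0\}=I_0\le\dots\le I_n=B$ such that for each $i$, either $(I_{i+1}/I_i,+)$ is infinite cyclic and $I_{i+1}/I_i\le\operatorname{Soc}(B/I_i)$, or $I_{i+1}/I_i$ has prime order. *)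

theory Defs
  imports "HOL-Algebra.Algebra" "HOL-Computational_Algebra.Primes"
begin

record 'a brace =
  bcar :: "'a set"
  badd :: "'a \<Rightarrow> 'a \<Rightarrow> 'a"
  bmul :: "'a \<Rightarrow> 'a \<Rightarrow> 'a"
  bzero :: "'a"

definition addG :: "'a brace \<Rightarrow> 'a monoid" where
  "addG B = \<lparr>partial_object.carrier = bcar B, monoid.mult = badd B, monoid.one = bzero B\<rparr>"

definition mulG :: "'a brace \<Rightarrow> 'a monoid" where
  "mulG B = \<lparr>partial_object.carrier = bcar B, monoid.mult = bmul B,
     monoid.one = (THE e. e \<in> bcar B \<and> (\<forall>x\<in>bcar B. bmul B e x = x \<and> bmul B x e = x))\<rparr>"

definition bneg :: "'a brace \<Rightarrow> 'a \<Rightarrow> 'a" where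
  "bneg B a = inv\<^bsub>addG B\<^esub> a"

definition is_brace :: "'a brace \<Rightarrow> bool" where
  "is_brace B \<longleftrightarrow> group (addG B)
     \<and> (\<exists>e. group \<lparr>partial_object.carrier = bcar B, monoid.mult = bmul B, monoid.one = e\<rparr>)
     \<and> (\<forall>a\<in>bcar B. \<forall>b\<in>bcar B. \<forall>c\<in>bcar B.
          bmul B a (badd B b c) = badd B (badd B (bmul B a b) (bneg B a)) (bmul B a c))"

definition blambda :: "'a brace \<Rightarrow> 'a \<Rightarrow> 'a \<Rightarrow> 'a" where
  "blambda B a b = badd B (bneg B a) (bmul B a b)"

definition is_ideal :: "'a brace \<Rightarrow> 'a set \<Rightarrow> bool" where
  "is_ideal B I \<longleftrightarrow> subgroup I (addG B) \<and> subgroup I (mulG B)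
     \<and> normal I (addG B) \<and> normal I (mulG B)
     \<and> (\<forall>b\<in>bcar B. blambda B b ` I \<subseteq> I)"

text \<open>Quotient brace B/I: elements are the additive cosets a + I; operations are
  induced elementwise (for an ideal I these are the usual quotient operations).\<close>
definition bquot :: "'a brace \<Rightarrow> 'a set \<Rightarrow> 'a set brace" where
  "bquot B I = \<lparr>bcar = (\<lambda>a. a <#\<^bsub>addG B\<^esub> I) ` bcar B,
     badd = (\<lambda>U V. set_mult (addG B) U V),
     bmul = (\<lambda>U V. set_mult (mulG B) U V),
     bzero = I\<rparr>"

definition bsoc :: "'a brace \<Rightarrow> 'a set" where
  "bsoc B = {a \<in> bcar B. (\<forall>b\<in>bcar B. blambda B a b = b)
                        \<and> (\<forall>b\<in>bcar B. badd B a b = badd B b a)}"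

fun soc_series :: "'a brace \<Rightarrow> nat \<Rightarrow> 'a set" where
  "soc_series B 0 = {bzero B}"
| "soc_series B (Suc k) =
     {x \<in> bcar B. x <#\<^bsub>addG B\<^esub> soc_series B k \<in> bsoc (bquot B (soc_series B k))}"

definition supersoluble :: "'a brace \<Rightarrow> bool" where
  "supersoluble B \<longleftrightarrow> (\<exists>(n::nat) (I :: nat \<Rightarrow> 'a set).
     I 0 = {bzero B} \<and> I n = bcar B
     \<and> (\<forall>i\<le>n. is_ideal B (I i))
     \<and> (\<forall>i<n. I i \<subseteq> I (Suc i))
     \<and> (\<forall>i<n. let Q = bquot B (I i); J = (\<lambda>a. a <#\<^bsub>addG B\<^esub> I i) ` I (Suc i) in
          (infinite J \<and> (\<exists>g\<in>J. J = range (\<lambda>k::int. g [^]\<^bsub>addG Q\<^esub> k)) \<and> J \<subseteq> bsoc Q)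
          \<or> Factorial_Ring.prime (card J)))"

fun lower_central :: "('a, 'b) monoid_scheme \<Rightarrow> nat \<Rightarrow> 'a set" where
  "lower_central G 0 = carrier G"
| "lower_central G (Suc n) = generate G
     {x \<otimes>\<^bsub>G\<^esub> y \<otimes>\<^bsub>G\<^esub> inv\<^bsub>G\<^esub> x \<otimes>\<^bsub>G\<^esub> inv\<^bsub>G\<^esub> y | x y. x \<in> carrier G \<and> y \<in> lower_central G n}"

definition nilpotent_group :: "('a, 'b) monoid_scheme \<Rightarrow> bool" where
  "nilpotent_group G \<longleftrightarrow> (\<exists>n. lower_central G n = {\<one>\<^bsub>G\<^esub>})"

end

(* The heart of the matter: in a brace with nilpotent additive group, an ideal K of prime order
   lies in the socle. K is additively central because it is a minimal normal subgroup of a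
   nilpotent group. For a in K and any b, lam_a(b) = b + f with f in K. If f is nonzero, it
   generates K, so by additivity of lam_a some multiple c of b satisfies lam_a(c) = c - a,
   that is a c = a + lam_a(c) = c, and a is trivial. Applied in the quotients by the members of a
   supersoluble chain, this puts every factor I_(i+1)/I_i into the socle of B/I_i, whence
   I_k is contained in Soc_k. Conversely, Soc_(k+1)/Soc_k is additively central, so the
   socle series dominates the lower central series. *)

theory Submission
  imports Defs
begin

section \<open>The two group structures attached to a brace\<close>

lemma addG_simps [simp]:
  "carrier (addG B) = bcar B" "monoid.mult (addG B) = badd B" "monoid.one (addG B) = bzero B"
  by (simp_all add: addG_def)

lemma mulG_simps [simp]:
  "carrier (mulG B) = bcar B" "monoid.mult (mulG B) = bmul B"
  by (simp_all add: mulG_def)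

text \<open>\<open>mulG\<close> picks its unit by a definite description, whereas
  \<open>is_brace\<close> only asserts that some unit exists. Uniqueness of the identity reconciles
  the two.\<close>

lemma mulG_eqI:
  assumes "group \<lparr>partial_object.carrier = bcar B, monoid.mult = bmul B, monoid.one = e\<rparr>"
  shows "mulG B = \<lparr>partial_object.carrier = bcar B, monoid.mult = bmul B, monoid.one = e\<rparr>"
proof -
  interpret group "\<lparr>partial_object.carrier = bcar B, monoid.mult = bmul B, monoid.one = e\<rparr>"
    by fact
  have e: "e \<in> bcar B" "\<And>x. x \<in> bcar B \<Longrightarrow> bmul B e x = x \<and> bmul B x e = x"
    using one_closed l_one r_one by simp_all
  have "(THE e. e \<in> bcar B \<and> (\<forall>x\<in>bcar B. bmul B e x = x \<and> bmul B x e = x)) = e"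
    using e by (intro the_equality) (blast, metis)
  then show ?thesis
    by (simp add: mulG_def)
qed

section \<open>Nilpotent groups: normal subgroups of prime order and homomorphic images\<close>

lemma commutator_in_normal:
  assumes "N \<lhd> G" "g \<in> carrier G" "x \<in> N"
  shows "g \<otimes>\<^bsub>G\<^esub> x \<otimes>\<^bsub>G\<^esub> inv\<^bsub>G\<^esub> g \<otimes>\<^bsub>G\<^esub> inv\<^bsub>G\<^esub> x \<in> N"
proof -
  interpret normal N G by fact
  show ?thesis
    using assms by (simp add: inv_op_closed2)
qed

lemma (in group) subgroup_of_prime_card:
  assumes K: "subgroup K G" "Factorial_Ring.prime (card K)" and M: "subgroup M G" "M \<subseteq> K"
  shows "M = {\<one>} \<or> M = K"
proof -
  interpret K: group "G\<lparr>carrier := K\<rparr>"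
    by (rule subgroup_imp_group[OF K(1)])
  \<comment> \<open>An infinite set has \<open>card\<close> 0, which is not prime.\<close>
  have fin: "finite K"
    using K(2) card.infinite[of K] not_prime_0 by metis
  have "subgroup M (G\<lparr>carrier := K\<rparr>)"
    using K(1) M by (simp add: subgroup_incl)
  from K.lagrange[OF this] have "card K = card M * card (rcosets\<^bsub>G\<lparr>carrier := K\<rparr>\<^esub> M)"
    by (simp add: order_def mult.commute)
  then have "card M dvd card K" ..
  then have "card M = 1 \<or> card M = card K"
    using K(2) by (auto simp: prime_nat_iff)
  then show ?thesis
  proof
    assume "card M = 1"
    then obtain x where "M = {x}"
      by (rule card_1_singletonE)
    then have "M = {\<one>}"
      using subgroup.one_closed[OF M(1)] by simp
    then show ?thesis ..
  next
    assume "card M = card K"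
    then have "M = K"
      by (rule card_subset_eq[OF fin M(2)])
    then show ?thesis ..
  qed
qed

text \<open>The elements of \<open>N\<close> that are central in the group form a subgroup
  \<open>M\<close> of \<open>N\<close>. Since \<open>N\<close> has prime order, one nontrivial
  central element in \<open>N\<close> suffices, and the last lower central term that meets
  \<open>N\<close> nontrivially supplies it.\<close>

lemma (in group) nilpotent_prime_normal_central:
  assumes nil: "nilpotent_group G" and N: "N \<lhd> G" "Factorial_Ring.prime (card N)"
    and x: "x \<in> N" and g: "g \<in> carrier G"
  shows "g \<otimes> x = x \<otimes> g"
proof -
  interpret N: normal N G by fact
  define M where "M = {x \<in> N. \<forall>g\<in>carrier G. g \<otimes> x = x \<otimes> g}"
  have comm: "a \<otimes> b = b \<otimes> a" if "a \<otimes> b \<otimes> inv a \<otimes> inv b = \<one>" "a \<in> carrier G" "b \<in> carrier G" for a b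
  proof -
    have "a \<otimes> b \<otimes> inv (b \<otimes> a) = \<one>"
      using that by (simp add: inv_mult_group m_assoc)
    then show ?thesis
      using that by (metis inv_closed inv_equality inv_inv m_closed)
  qed
  have "subgroup M G"
  proof (rule subgroupI)
    show "M \<subseteq> carrier G" "M \<noteq> {}"
      using N.one_closed unfolding M_def by (auto intro!: exI[of _ \<one>])
    show "inv a \<in> M" if "a \<in> M" for a
    proof -
      have "g \<otimes> inv a = inv a \<otimes> g" if "g \<in> carrier G" for g
      proof -
        have a: "a \<in> carrier G" "g \<otimes> a = a \<otimes> g"
          using \<open>a \<in> M\<close> that by (auto simp: M_def)
        have "g \<otimes> inv a = inv a \<otimes> (a \<otimes> g) \<otimes> inv a"
          using a(1) that by (simp flip: m_assoc)
        also have "\<dots> = inv a \<otimes> (g \<otimes> a) \<otimes> inv a"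
          using a by simp
        also have "\<dots> = inv a \<otimes> g"
          using a(1) that by (simp add: m_assoc)
        finally show ?thesis .
      qed
      then show ?thesis
        using that by (auto simp: M_def)
    qed
    show "a \<otimes> b \<in> M" if "a \<in> M" "b \<in> M" for a b
    proof -
      have ab: "a \<in> N" "b \<in> N" "a \<in> carrier G" "b \<in> carrier G"
        using that by (auto simp: M_def)
      have "g \<otimes> (a \<otimes> b) = a \<otimes> b \<otimes> g" if g: "g \<in> carrier G" for g
      proof -
        have "g \<otimes> (a \<otimes> b) = g \<otimes> a \<otimes> b"
          using ab g by (simp add: m_assoc)
        also have "\<dots> = a \<otimes> (g \<otimes> b)"
          using ab g \<open>a \<in> M\<close> by (simp add: M_def m_assoc)
        also have "\<dots> = a \<otimes> (b \<otimes> g)"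
          using g \<open>b \<in> M\<close> by (simp add: M_def)
        also have "\<dots> = a \<otimes> b \<otimes> g"
          using ab g by (simp add: m_assoc)
        finally show ?thesis .
      qed
      then show ?thesis
        using ab by (auto simp: M_def)
    qed
  qed
  moreover have "M \<subseteq> N"
    by (auto simp: M_def)
  moreover have "M \<noteq> {\<one>}"
  proof -
    obtain n where n: "lower_central G n = {\<one>}"
      using nil by (auto simp: nilpotent_group_def)
    \<comment> \<open>A nontrivial \<open>y\<close> in \<open>N\<close> and in the term just before
      \<open>j\<close> has all its commutators both in \<open>N\<close> (by normality) and in term
      \<open>j\<close>, so they are trivial and \<open>y\<close> is central.\<close>
    define j where "j = (LEAST j. lower_central G j \<inter> N \<subseteq> {\<one>})"
    have j: "lower_central G j \<inter> N \<subseteq> {\<one>}"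
      unfolding j_def by (rule LeastI[of _ n]) (use n in auto)
    have "\<not> N \<subseteq> {\<one>}"
      using N(2) card_mono[of "{\<one>}" N] prime_gt_1_nat[of "card N"] by auto
    \<comment> \<open>Term 0 is the whole group, so \<open>j = 0\<close> would make \<open>N\<close>
      trivial.\<close>
    then have "j \<noteq> 0"
      using j N.subset by (cases j) auto
    then obtain i where i: "j = Suc i"
      by (cases j) auto
    have "\<not> lower_central G i \<inter> N \<subseteq> {\<one>}"
      using not_less_Least[of i "\<lambda>j. lower_central G j \<inter> N \<subseteq> {\<one>}"] i j_def by auto
    then obtain y where y: "y \<in> lower_central G i" "y \<in> N" "y \<noteq> \<one>"
      by auto
    have "g \<otimes> y = y \<otimes> g" if g: "g \<in> carrier G" for g
    proof -
      have "g \<otimes> y \<otimes> inv g \<otimes> inv y \<in> lower_central G j"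
        unfolding i lower_central.simps using y g by (blast intro: generate.incl)
      then have "g \<otimes> y \<otimes> inv g \<otimes> inv y = \<one>"
        using commutator_in_normal[OF N(1) g y(2)] j by auto
      then show ?thesis
        using g N.mem_carrier[OF y(2)] by (rule comm)
    qed
    then have "y \<in> M"
      using y by (auto simp: M_def)
    then show ?thesis
      using y by auto
  qed
  ultimately have "M = N"
    using subgroup_of_prime_card[OF N.subgroup_axioms N(2)] by blast
  then show ?thesis
    using x g by (auto simp: M_def)
qed

text \<open>By surjectivity every commutator in \<open>H\<close> lifts to one in \<open>G\<close>,
  and generating a subgroup commutes with taking images. The inclusion in the carrier is part of the
  induction because \<open>h\<close> respects the operations only there.\<close>

lemma (in group_hom) lower_central_image:
  assumes surj: "h ` carrier G = carrier H"
  shows "lower_central H n = h ` lower_central G n \<and> lower_central G n \<subseteq> carrier G"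
proof (induction n)
  case 0
  then show ?case using surj by auto
next
  case (Suc n)
  define S where "S = {x \<otimes> y \<otimes> inv x \<otimes> inv y | x y. x \<in> carrier G \<and> y \<in> lower_central G n}"
  have S: "S \<subseteq> carrier G"
    using Suc by (auto simp: S_def)
  have hc: "h (x \<otimes> y \<otimes> inv x \<otimes> inv y)
      = h x \<otimes>\<^bsub>H\<^esub> h y \<otimes>\<^bsub>H\<^esub> inv\<^bsub>H\<^esub> h x \<otimes>\<^bsub>H\<^esub> inv\<^bsub>H\<^esub> h y"
    if "x \<in> carrier G" "y \<in> lower_central G n" for x y
  proof -
    have "y \<in> carrier G"
      using Suc that by auto
    then show ?thesis
      using that by simp
  qed
  have "{x \<otimes>\<^bsub>H\<^esub> y \<otimes>\<^bsub>H\<^esub> inv\<^bsub>H\<^esub> x \<otimes>\<^bsub>H\<^esub> inv\<^bsub>H\<^esub> y | x y.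
      x \<in> carrier H \<and> y \<in> lower_central H n} = h ` S" (is "?Y = _")
  proof
    show "?Y \<subseteq> h ` S"
    proof
      fix z assume "z \<in> ?Y"
      then obtain x y where "x \<in> carrier H" "y \<in> lower_central H n"
        and z: "z = x \<otimes>\<^bsub>H\<^esub> y \<otimes>\<^bsub>H\<^esub> inv\<^bsub>H\<^esub> x \<otimes>\<^bsub>H\<^esub> inv\<^bsub>H\<^esub> y"
        by blast
      then obtain x' y' where *: "x' \<in> carrier G" "y' \<in> lower_central G n" "x = h x'" "y = h y'"
        using Suc surj by blast
      then show "z \<in> h ` S"
        unfolding z * using hc[OF *(1,2), symmetric] by (auto simp: S_def)
    qed
    show "h ` S \<subseteq> ?Y"
      using Suc hc by (fastforce simp: S_def)
  qed
  then have "lower_central H (Suc n) = h ` lower_central G (Suc n)"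
    using generate_img[OF S] by (simp add: S_def)
  moreover have "lower_central G (Suc n) \<subseteq> carrier G"
    using G.generate_incl[OF S] by (simp add: S_def)
  ultimately show ?case
    by blast
qed

lemma (in group_hom) nilpotent_image:
  assumes "h ` carrier G = carrier H" "nilpotent_group G"
  shows "nilpotent_group H"
proof -
  obtain n where "lower_central G n = {\<one>}"
    using assms(2) by (auto simp: nilpotent_group_def)
  then have "lower_central H n = {\<one>\<^bsub>H\<^esub>}"
    using lower_central_image[OF assms(1), of n] by simp
  then show ?thesis
    by (auto simp: nilpotent_group_def)
qed

section \<open>Arithmetic in a brace and the action lambda\<close>

locale brace =
  fixes B :: "'a brace"
  assumes is_brace: "is_brace B"
begin

abbreviation add (infixl "\<boxplus>" 65) where "add \<equiv> badd B"
abbreviation mul (infixl "\<boxdot>" 70) where "mul \<equiv> bmul B"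
abbreviation neg ("\<boxminus> _" [81] 80) where "neg \<equiv> bneg B"
abbreviation recip where "recip \<equiv> m_inv (mulG B)"
abbreviation lam where "lam \<equiv> blambda B"
abbreviation zero ("\<nought>") where "zero \<equiv> bzero B"

lemma m_inv_addG: "m_inv (addG B) = bneg B"
  by (auto simp: bneg_def)

sublocale A: group "addG B"
  rewrites "carrier (addG B) = bcar B" and "monoid.mult (addG B) = badd B"
    and "monoid.one (addG B) = bzero B" and "m_inv (addG B) = bneg B"
  using is_brace by (auto simp: is_brace_def m_inv_addG)

lemma distrib:
  "a \<in> bcar B \<Longrightarrow> b \<in> bcar B \<Longrightarrow> c \<in> bcar B \<Longrightarrow> a \<boxdot> (b \<boxplus> c) = a \<boxdot> b \<boxplus> \<boxminus> a \<boxplus> a \<boxdot> c"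
  using is_brace by (simp add: is_brace_def)

lemma neg_add_cancel [simp]:
  "a \<in> bcar B \<Longrightarrow> b \<in> bcar B \<Longrightarrow> \<boxminus> a \<boxplus> (a \<boxplus> b) = b"
  "a \<in> bcar B \<Longrightarrow> b \<in> bcar B \<Longrightarrow> a \<boxplus> (\<boxminus> a \<boxplus> b) = b"
  by (simp_all flip: A.m_assoc)

text \<open>The two identities coincide: expanding e(0 + 0) by the brace law gives 0 = 0 - e + 0 for
  the multiplicative unit e.\<close>

lemma group_mulG: "group (mulG B)" and one_mulG: "monoid.one (mulG B) = bzero B"
proof -
  obtain e where e: "group \<lparr>partial_object.carrier = bcar B, monoid.mult = bmul B, monoid.one = e\<rparr>"
    using is_brace by (auto simp: is_brace_def)
  note eq = mulG_eqI[OF e]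
  show "group (mulG B)"
    using e eq by simp
  then interpret M: group "mulG B" .
  have e1: "monoid.one (mulG B) = e" "e \<in> bcar B"
    using eq M.one_closed by simp_all
  have "e \<boxdot> (\<nought> \<boxplus> \<nought>) = e \<boxdot> \<nought> \<boxplus> \<boxminus> e \<boxplus> e \<boxdot> \<nought>"
    using e1 by (intro distrib) auto
  moreover have "e \<boxdot> \<nought> = \<nought>"
    using M.l_one[of \<nought>] e1 by simp
  ultimately have "\<nought> = \<boxminus> e"
    using e1 by simp
  then show "monoid.one (mulG B) = \<nought>"
    using e1 by (metis A.inv_inv A.inv_one)
qed

sublocale M: group "mulG B"
  rewrites "carrier (mulG B) = bcar B" and "monoid.mult (mulG B) = bmul B"
    and "monoid.one (mulG B) = bzero B"
  using group_mulG one_mulG by auto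

lemma recip_mul_cancel [simp]:
  "a \<in> bcar B \<Longrightarrow> b \<in> bcar B \<Longrightarrow> recip a \<boxdot> (a \<boxdot> b) = b"
  "a \<in> bcar B \<Longrightarrow> b \<in> bcar B \<Longrightarrow> a \<boxdot> (recip a \<boxdot> b) = b"
  by (simp_all flip: M.m_assoc)

lemma lam_closed [simp]: "a \<in> bcar B \<Longrightarrow> b \<in> bcar B \<Longrightarrow> lam a b \<in> bcar B"
  by (simp add: blambda_def)

lemma mul_eq: "a \<in> bcar B \<Longrightarrow> b \<in> bcar B \<Longrightarrow> a \<boxdot> b = a \<boxplus> lam a b"
  by (simp add: blambda_def)

lemma lam_add:
  "a \<in> bcar B \<Longrightarrow> b \<in> bcar B \<Longrightarrow> c \<in> bcar B \<Longrightarrow> lam a (b \<boxplus> c) = lam a b \<boxplus> lam a c"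
  by (simp add: blambda_def distrib A.m_assoc)

lemma lam_zero [simp]: "a \<in> bcar B \<Longrightarrow> lam a \<nought> = \<nought>"
  by (simp add: blambda_def)

lemma lam_neg: "a \<in> bcar B \<Longrightarrow> b \<in> bcar B \<Longrightarrow> lam a (\<boxminus> b) = \<boxminus> lam a b"
  using lam_add[of a "\<boxminus> b" b] by (simp add: A.inv_equality)

text \<open>Both sides, added to ab on the left, give the product abc; cancelling ab yields the
  claim.\<close>

lemma lam_mul:
  assumes "a \<in> bcar B" "b \<in> bcar B" "c \<in> bcar B"
  shows "lam (a \<boxdot> b) c = lam a (lam b c)"
proof -
  have "a \<boxdot> b \<boxplus> lam (a \<boxdot> b) c = a \<boxdot> (b \<boxplus> lam b c)"
    using assms by (simp add: M.m_assoc flip: mul_eq)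
  also have "\<dots> = a \<boxdot> b \<boxplus> lam a (lam b c)"
    using assms by (simp add: distrib A.m_assoc blambda_def[of B a])
  finally show ?thesis
    using assms by simp
qed

lemma lam_one [simp]: "b \<in> bcar B \<Longrightarrow> lam \<nought> b = b"
  by (simp add: blambda_def)

lemma lam_recip [simp]:
  "a \<in> bcar B \<Longrightarrow> b \<in> bcar B \<Longrightarrow> lam a (lam (recip a) b) = b"
  "a \<in> bcar B \<Longrightarrow> b \<in> bcar B \<Longrightarrow> lam (recip a) (lam a b) = b"
  by (simp_all flip: lam_mul)

section \<open>Ideals and the socle\<close>

text \<open>Multiplicative closure need not be checked separately. It follows from ab = a +
  lam_a(b), and inverses are covered because \<open>recip a\<close> is the negative of
  \<open>lam (recip a) a\<close>.\<close>

lemma is_idealI: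
  assumes I: "I \<subseteq> bcar B" "\<nought> \<in> I"
    and add: "\<And>a b. a \<in> I \<Longrightarrow> b \<in> I \<Longrightarrow> a \<boxplus> b \<in> I"
    and neg: "\<And>a. a \<in> I \<Longrightarrow> \<boxminus> a \<in> I"
    and conj_add: "\<And>a b. a \<in> I \<Longrightarrow> b \<in> bcar B \<Longrightarrow> b \<boxplus> a \<boxplus> \<boxminus> b \<in> I"
    and lam: "\<And>a b. a \<in> I \<Longrightarrow> b \<in> bcar B \<Longrightarrow> lam b a \<in> I"
    and conj_mul: "\<And>a b. a \<in> I \<Longrightarrow> b \<in> bcar B \<Longrightarrow> b \<boxdot> a \<boxdot> recip b \<in> I"
  shows "is_ideal B I"
proof -
  have A: "subgroup I (addG B)"
    using I add neg by (intro A.subgroupI) (auto simp: m_inv_addG)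
  have "recip a \<in> I" if "a \<in> I" for a
  proof -
    have a: "a \<in> bcar B"
      using I that by auto
    then have "\<nought> = recip a \<boxplus> lam (recip a) a"
      by (simp flip: mul_eq)
    then have "recip a = \<boxminus> lam (recip a) a"
      using a by (simp add: A.inv_equality)
    then show ?thesis
      using lam neg that a by (metis M.inv_closed)
  qed
  moreover have "a \<boxdot> b \<in> I" if "a \<in> I" "b \<in> I" for a b
    using that I add lam by (metis mul_eq subsetD)
  ultimately have M: "subgroup I (mulG B)"
    using I by (intro M.subgroupI) (auto)
  show ?thesis
    unfolding is_ideal_def using A M lam conj_add conj_mul
    by (auto simp: A.normal_inv_iff M.normal_inv_iff m_inv_addG)
qed

text \<open>Phrased with the two operations alone, membership says that multiplying by
  \<open>a\<close> on the left is adding \<open>a\<close>, and that \<open>a\<close> is additively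
  central. These equations pass easily to cosets.\<close>

lemma soc_iff:
  "a \<in> bsoc B \<longleftrightarrow> a \<in> bcar B \<and> (\<forall>b\<in>bcar B. a \<boxdot> b = a \<boxplus> b \<and> a \<boxplus> b = b \<boxplus> a)"
proof -
  have "lam a b = b \<longleftrightarrow> a \<boxdot> b = a \<boxplus> b" if "a \<in> bcar B" "b \<in> bcar B" for b
    using that by (simp add: mul_eq)
  then show ?thesis
    by (auto simp: bsoc_def)
qed

lemma is_ideal_soc: "is_ideal B (bsoc B)"
proof (rule is_idealI)
  show "bsoc B \<subseteq> bcar B" "\<nought> \<in> bsoc B"
    by (auto simp: soc_iff)
  have mul: "a \<boxdot> b = a \<boxplus> b" and comm: "b \<boxplus> a = a \<boxplus> b" and car: "a \<in> bcar B"
    if "a \<in> bsoc B" "b \<in> bcar B" for a b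
    using that by (simp_all add: soc_iff)
  show "a \<boxplus> c \<in> bsoc B" if ac: "a \<in> bsoc B" "c \<in> bsoc B" for a c
  proof -
    have car': "a \<in> bcar B" "c \<in> bcar B"
      using ac by (simp_all add: soc_iff)
    have "(a \<boxplus> c) \<boxdot> b = a \<boxplus> c \<boxplus> b" if "b \<in> bcar B" for b
    proof -
      have "(a \<boxplus> c) \<boxdot> b = (a \<boxdot> c) \<boxdot> b"
        using mul ac car' by simp
      also have "\<dots> = a \<boxdot> (c \<boxdot> b)"
        using car' that by (simp add: M.m_assoc)
      also have "\<dots> = a \<boxplus> c \<boxplus> b"
        using ac car' that by (simp add: A.m_assoc mul)
      finally show ?thesis .
    qed
    moreover have "a \<boxplus> c \<boxplus> b = b \<boxplus> (a \<boxplus> c)" if "b \<in> bcar B" for b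
      using ac car' that by (metis A.m_assoc comm)
    ultimately show ?thesis
      using car' by (simp add: soc_iff)
  qed
  show "\<boxminus> a \<in> bsoc B" if a: "a \<in> bsoc B" for a
  proof -
    have a': "a \<in> bcar B"
      using a by (simp add: soc_iff)
    have "\<boxminus> a \<boxdot> b = \<boxminus> a \<boxplus> b \<and> \<boxminus> a \<boxplus> b = b \<boxplus> \<boxminus> a" if b: "b \<in> bcar B" for b
    proof
      \<comment> \<open>Since multiplication by \<open>a\<close> is addition, the negative of
        \<open>a\<close> is also its reciprocal.\<close>
      have "a \<boxdot> \<boxminus> a = \<nought>"
        using a a' by (simp add: mul)
      then have rec: "\<boxminus> a = recip a"
        using a' by (metis A.inv_closed M.inv_equality M.inv_inv)
      \<comment> \<open>Writing b as a + (-a + b) produces a sum with \<open>a\<close> that can be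
        read as a product with \<open>a\<close>, which \<open>recip a\<close> then cancels.\<close>
      have "\<boxminus> a \<boxdot> b = recip a \<boxdot> (a \<boxplus> (\<boxminus> a \<boxplus> b))"
        using a' b by (simp flip: rec)
      also have "\<dots> = recip a \<boxdot> (a \<boxdot> (\<boxminus> a \<boxplus> b))"
        using a a' b by (simp add: mul)
      finally show "\<boxminus> a \<boxdot> b = \<boxminus> a \<boxplus> b"
        using a' b by simp
      have "\<boxminus> a \<boxplus> b = \<boxminus> a \<boxplus> (b \<boxplus> a) \<boxplus> \<boxminus> a"
        using a' b by (simp add: A.m_assoc)
      also have "\<dots> = b \<boxplus> \<boxminus> a"
        using a a' b by (simp add: comm)
      finally show "\<boxminus> a \<boxplus> b = b \<boxplus> \<boxminus> a" .
    qed
    then show ?thesis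
      using a' by (simp add: soc_iff)
  qed
  show "b \<boxplus> a \<boxplus> \<boxminus> b \<in> bsoc B" if "a \<in> bsoc B" "b \<in> bcar B" for a b
    using that car[OF that] by (simp add: comm A.m_assoc)
  \<comment> \<open>An additive automorphism preserves the centre; here \<open>c\<close> is pulled
    back along \<open>lam b\<close> by \<open>lam (recip b)\<close>.\<close>
  have lam_comm: "lam b a \<boxplus> c = c \<boxplus> lam b a" if "a \<in> bsoc B" "b \<in> bcar B" "c \<in> bcar B" for a b c
  proof -
    have "lam b a \<boxplus> c = lam b (a \<boxplus> lam (recip b) c)"
      using that car[OF that(1,2)] by (simp add: lam_add)
    also have "\<dots> = lam b (lam (recip b) c \<boxplus> a)"
      using that by (simp add: comm)
    also have "\<dots> = c \<boxplus> lam b a"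
      using that car[OF that(1,2)] by (simp add: lam_add)
    finally show ?thesis .
  qed
  \<comment> \<open>On the socle, multiplicative conjugation is the lambda action, so invariance
    under one gives invariance under the other.\<close>
  have conj: "b \<boxdot> a \<boxdot> recip b = lam b a" if ab: "a \<in> bsoc B" "b \<in> bcar B" for a b
  proof -
    have a: "a \<in> bcar B"
      by (rule car[OF ab])
    have "b \<boxdot> a \<boxdot> recip b = b \<boxdot> (a \<boxplus> recip b)"
      using ab a by (simp add: M.m_assoc mul)
    also have "\<dots> = b \<boxplus> lam b a \<boxplus> \<boxminus> b"
      using ab a by (simp add: distrib mul_eq[of b a])
    also have "\<dots> = lam b a"
      using ab a lam_comm[OF ab ab(2)] by (simp add: A.m_assoc flip: lam_comm)
    finally show ?thesis .
  qed
  show lam: "lam b a \<in> bsoc B" if ab: "a \<in> bsoc B" "b \<in> bcar B" for a b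
  proof -
    have a: "a \<in> bcar B"
      by (rule car[OF ab])
    have "lam b a \<boxdot> c = lam b a \<boxplus> c" if c: "c \<in> bcar B" for c
    proof -
      have "lam b a \<boxdot> c = b \<boxdot> (a \<boxdot> (recip b \<boxdot> c))"
        using ab a c by (simp add: M.m_assoc flip: conj)
      also have "\<dots> = b \<boxdot> (a \<boxplus> recip b \<boxdot> c)"
        using ab c by (simp add: mul)
      also have "\<dots> = b \<boxplus> lam b a \<boxplus> \<boxminus> b \<boxplus> c"
        using ab a c by (simp add: distrib mul_eq[of b a])
      also have "\<dots> = lam b a \<boxplus> c"
        using ab a c by (simp add: A.m_assoc flip: lam_comm)
      finally show ?thesis .
    qed
    then show ?thesis
      using ab a lam_comm[OF ab] by (simp add: soc_iff)
  qed
  show "b \<boxdot> a \<boxdot> recip b \<in> bsoc B" if "a \<in> bsoc B" "b \<in> bcar B" for a b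
    using that by (simp add: conj lam)
qed

section \<open>Ideals of prime order when the additive group is nilpotent\<close>

lemma prime_ideal_subset_soc:
  assumes nil: "nilpotent_group (addG B)"
    and K: "is_ideal B K" and prime: "Factorial_Ring.prime (card K)"
  shows "K \<subseteq> bsoc B"
proof
  fix a assume a: "a \<in> K"
  interpret KA: normal K "addG B"
    rewrites "carrier (addG B) = bcar B" and "monoid.mult (addG B) = badd B"
      and "monoid.one (addG B) = bzero B" and "m_inv (addG B) = bneg B"
    using K by (auto simp: is_ideal_def m_inv_addG)
  interpret KM: normal K "mulG B"
    rewrites "carrier (mulG B) = bcar B" and "monoid.mult (mulG B) = bmul B"
      and "monoid.one (mulG B) = bzero B"
    using K by (auto simp: is_ideal_def one_mulG)
  have K_lam: "lam b k \<in> K" if "b \<in> bcar B" "k \<in> K" for b k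
    using K that by (auto simp: is_ideal_def)
  have comm: "b \<boxplus> k = k \<boxplus> b" if "b \<in> bcar B" "k \<in> K" for b k
    using A.nilpotent_prime_normal_central[OF nil KA.normal_axioms prime that(2,1)] .
  have a': "a \<in> bcar B"
    using a by simp
  \<comment> \<open>The possible displacements form a subgroup of \<open>K\<close>, hence all of \<open>K\<close> or nothing.\<close>
  define M where "M = {k \<in> K. \<exists>b\<in>bcar B. lam a b = b \<boxplus> k}"
  have M: "subgroup M (addG B)"
  proof (rule A.subgroupI)
    show "M \<subseteq> bcar B"
      by (auto simp: M_def)
    have "\<nought> \<in> M"
      using a' by (auto simp: M_def intro!: bexI[of _ \<nought>])
    then show "M \<noteq> {}"
      by blast
    show "\<boxminus> k \<in> M" if "k \<in> M" for k
    proof -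
      obtain b where b: "b \<in> bcar B" "lam a b = b \<boxplus> k" and k: "k \<in> K"
        using \<open>k \<in> M\<close> by (auto simp: M_def)
      then have "lam a (\<boxminus> b) = \<boxminus> b \<boxplus> \<boxminus> k"
        using a' comm[of "\<boxminus> b" "\<boxminus> k"] by (simp add: lam_neg A.inv_mult_group)
      then show ?thesis
        using b k by (auto simp: M_def intro!: bexI[of _ "\<boxminus> b"])
    qed
    show "k \<boxplus> l \<in> M" if "k \<in> M" "l \<in> M" for k l
    proof -
      obtain b where b: "b \<in> bcar B" "lam a b = b \<boxplus> k" and k: "k \<in> K"
        using \<open>k \<in> M\<close> by (auto simp: M_def)
      obtain c where c: "c \<in> bcar B" "lam a c = c \<boxplus> l" and l: "l \<in> K"
        using \<open>l \<in> M\<close> by (auto simp: M_def)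
      have "lam a (b \<boxplus> c) = b \<boxplus> (k \<boxplus> c) \<boxplus> l"
        using a' b c k l by (simp add: lam_add A.m_assoc)
      also have "k \<boxplus> c = c \<boxplus> k"
        using comm[OF c(1) k] by (rule sym)
      finally have "lam a (b \<boxplus> c) = (b \<boxplus> c) \<boxplus> (k \<boxplus> l)"
        using b c k l by (simp add: A.m_assoc)
      then show ?thesis
        using b c k l by (auto simp: M_def intro!: bexI[of _ "b \<boxplus> c"])
    qed
  qed
  have M_cases: "M = {\<nought>} \<or> M = K"
    using A.subgroup_of_prime_card[OF KA.subgroup_axioms prime M] by (auto simp: M_def)
  have "a \<boxdot> b = a \<boxplus> b" if b: "b \<in> bcar B" for b
  proof (cases "M = K")
    case True
    \<comment> \<open>This displacement is chosen because it undoes the summand \<open>a\<close>: ac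
      = a + c - a = c by centrality of \<open>K\<close>, which forces a = 0.\<close>
    then have "\<boxminus> a \<in> M"
      using a by simp
    then obtain c where c: "c \<in> bcar B" "lam a c = c \<boxplus> \<boxminus> a"
      by (auto simp: M_def)
    then have "a \<boxdot> c = c"
      using a a' comm[of c "\<boxminus> a"] by (simp add: mul_eq)
    then have "a = \<nought>"
      using a' c by simp
    then show ?thesis
      using b by simp
  next
    case False
    \<comment> \<open>Multiplicative normality shows that the displacement of \<open>b\<close> lies
      in \<open>K\<close>: ab = bk expands to a + lam_a(b) = b + lam_b(k), so lam_a(b) = b +
      (lam_b(k) - a). As \<open>M\<close> is trivial in this case, the displacement
      vanishes.\<close>
    define k where "k = recip b \<boxdot> a \<boxdot> b"
    have k: "k \<in> K"
      unfolding k_def by (rule KM.inv_op_closed1[OF b a])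
    have "a \<boxdot> b = b \<boxdot> k"
      unfolding k_def using a' b by (simp add: M.m_assoc)
    then have "a \<boxplus> lam a b = b \<boxplus> lam b k"
      using a' b k by (simp add: mul_eq)
    then have "lam a b = \<boxminus> a \<boxplus> (b \<boxplus> lam b k)"
      using a' b k by (metis neg_add_cancel(1) lam_closed)
    also have "\<dots> = b \<boxplus> (lam b k \<boxplus> \<boxminus> a)"
      using a a' b k K_lam[OF b k] comm[of "b \<boxplus> lam b k" "\<boxminus> a"] by (simp add: A.m_assoc)
    finally have *: "lam a b = b \<boxplus> (lam b k \<boxplus> \<boxminus> a)" .
    then have "lam b k \<boxplus> \<boxminus> a \<in> M"
      using a b k K_lam[OF b k] by (auto simp: M_def intro!: bexI[of _ b])
    then have "lam b k \<boxplus> \<boxminus> a = \<nought>"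
      using False M_cases by simp
    then show ?thesis
      using * a' b by (simp add: mul_eq)
  qed
  then show "a \<in> bsoc B"
    using a a' by (simp add: soc_iff comm[of _ a])
qed

end

section \<open>Quotient braces\<close>

lemma (in normal) lcos_sum:
  "x \<in> carrier G \<Longrightarrow> y \<in> carrier G \<Longrightarrow> (x <# H) <#> (y <# H) = (x \<otimes> y) <# H"
  using rcos_sum coset_eq by simp

text \<open>\<open>Mod\<close> is built from right cosets and \<open>bquot\<close> from left ones;
  normality identifies them.\<close>

lemma (in normal) FactGroup_lcosets:
  "G Mod H = \<lparr>partial_object.carrier = (\<lambda>x. x <# H) ` carrier G, monoid.mult = set_mult G, monoid.one = H\<rparr>"
  using coset_eq by (auto simp: FactGroup_def RCOSETS_def)

locale brace_ideal = brace +
  fixes I :: "'a set"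
  assumes ideal: "is_ideal B I"
begin

abbreviation proj where "proj a \<equiv> a <#\<^bsub>addG B\<^esub> I"

sublocale IA: normal I "addG B"
  rewrites "carrier (addG B) = bcar B" and "monoid.mult (addG B) = badd B"
    and "monoid.one (addG B) = bzero B" and "m_inv (addG B) = bneg B"
  using ideal by (auto simp: is_ideal_def m_inv_addG)

sublocale IM: normal I "mulG B"
  rewrites "carrier (mulG B) = bcar B" and "monoid.mult (mulG B) = bmul B"
    and "monoid.one (mulG B) = bzero B"
  using ideal by (auto simp: is_ideal_def one_mulG)

lemma lam_ideal: "b \<in> bcar B \<Longrightarrow> a \<in> I \<Longrightarrow> lam b a \<in> I"
  using ideal by (auto simp: is_ideal_def)

lemma mem_proj: "b \<in> proj a \<longleftrightarrow> (\<exists>h\<in>I. b = a \<boxplus> h)"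
  by (auto simp: l_coset_def)

lemma proj_eq_iff:
  assumes "a \<in> bcar B" "b \<in> bcar B"
  shows "proj a = proj b \<longleftrightarrow> \<boxminus> a \<boxplus> b \<in> I"
proof
  assume eq: "proj a = proj b"
  have "b \<in> proj b"
    using assms by (auto simp: mem_proj intro!: bexI[of _ \<nought>])
  then obtain h where "h \<in> I" "b = a \<boxplus> h"
    unfolding eq[symmetric] mem_proj by blast
  then show "\<boxminus> a \<boxplus> b \<in> I"
    using assms by simp
next
  assume "\<boxminus> a \<boxplus> b \<in> I"
  then have "b \<in> proj a"
    using assms by (auto simp: mem_proj intro!: bexI[of _ "\<boxminus> a \<boxplus> b"])
  then show "proj a = proj b"
    using assms(1) IA.subgroup_axioms by (rule A.l_repr_independence)
qed

text \<open>The map \<open>lam a\<close> permutes the ideal and ah = a + lam_a(h), so both groups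
  have the same cosets. This is why multiplying additive cosets elementwise is the right operation
  in \<open>bquot\<close>.\<close>

lemma mul_coset_eq:
  assumes "a \<in> bcar B"
  shows "a <#\<^bsub>mulG B\<^esub> I = proj a"
proof -
  have "lam a ` I = I"
  proof
    show "lam a ` I \<subseteq> I"
      using assms lam_ideal by auto
    show "I \<subseteq> lam a ` I"
      using assms lam_ideal by (auto intro!: image_eqI[of _ _ "lam (recip a) x" for x])
  qed
  then have "proj a = (\<lambda>h. a \<boxplus> h) ` (lam a ` I)"
    by (auto simp: l_coset_def)
  also have "\<dots> = a <#\<^bsub>mulG B\<^esub> I"
    using assms by (auto simp: l_coset_def mul_eq)
  finally show ?thesis ..
qed

lemma addG_quot: "addG (bquot B I) = addG B Mod I"
  by (simp add: addG_def[of "bquot B I"] bquot_def IA.FactGroup_lcosets)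

lemma mulG_quot: "mulG (bquot B I) = mulG B Mod I"
proof -
  have "mulG B Mod I = \<lparr>partial_object.carrier = bcar (bquot B I),
      monoid.mult = bmul (bquot B I), monoid.one = I\<rparr>"
    by (auto simp: bquot_def IM.FactGroup_lcosets mul_coset_eq cong: image_cong_simp)
  then show ?thesis
    using mulG_eqI IM.factorgroup_is_group by metis
qed

lemma bcar_quot: "bcar (bquot B I) = proj ` bcar B"
  by (simp add: bquot_def)

lemma add_quot:
  "a \<in> bcar B \<Longrightarrow> b \<in> bcar B \<Longrightarrow> badd (bquot B I) (proj a) (proj b) = proj (a \<boxplus> b)"
  by (simp add: bquot_def IA.lcos_sum)

lemma mul_quot:
  "a \<in> bcar B \<Longrightarrow> b \<in> bcar B \<Longrightarrow> bmul (bquot B I) (proj a) (proj b) = proj (a \<boxdot> b)"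
  using IM.lcos_sum[of a b] by (simp add: bquot_def mul_coset_eq)

lemma group_addG_quot: "group (addG (bquot B I))"
  by (simp add: addG_quot IA.factorgroup_is_group)

lemma group_mulG_quot: "group (mulG (bquot B I))"
  by (simp add: mulG_quot IM.factorgroup_is_group)

lemma group_hom_add: "group_hom (addG B) (addG (bquot B I)) proj"
  by (intro group_hom.intro group_hom_axioms.intro homI)
     (auto simp: group_addG_quot bcar_quot add_quot A.is_group)

lemma group_hom_mul: "group_hom (mulG B) (mulG (bquot B I)) proj"
  by (intro group_hom.intro group_hom_axioms.intro homI)
     (auto simp: group_mulG_quot bcar_quot mul_quot M.is_group)

lemma neg_quot: "a \<in> bcar B \<Longrightarrow> bneg (bquot B I) (proj a) = proj (\<boxminus> a)"
  using group_hom.hom_inv[OF group_hom_add, of a] by (simp add: bneg_def)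

lemma recip_quot: "a \<in> bcar B \<Longrightarrow> m_inv (mulG (bquot B I)) (proj a) = proj (recip a)"
  using group_hom.hom_inv[OF group_hom_mul, of a] by simp

lemma lam_quot:
  "a \<in> bcar B \<Longrightarrow> b \<in> bcar B \<Longrightarrow> blambda (bquot B I) (proj a) (proj b) = proj (lam a b)"
  by (simp add: blambda_def neg_quot add_quot mul_quot)

lemmas proj_simps = add_quot mul_quot neg_quot recip_quot lam_quot

lemma is_brace_quot: "is_brace (bquot B I)"
proof -
  have "mulG (bquot B I) = \<lparr>partial_object.carrier = bcar (bquot B I),
      monoid.mult = bmul (bquot B I), monoid.one = monoid.one (mulG (bquot B I))\<rparr>"
    by (simp add: mulG_def)
  then have "\<exists>e. group \<lparr>partial_object.carrier = bcar (bquot B I), monoid.mult = bmul (bquot B I), monoid.one = e\<rparr>"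
    using group_mulG_quot by metis
  then show ?thesis
    by (auto simp: is_brace_def group_addG_quot bcar_quot proj_simps distrib)
qed

sublocale Q: brace "bquot B I"
  by (unfold_locales) (rule is_brace_quot)

lemma zero_quot: "bzero (bquot B I) = proj \<nought>"
  by (simp add: A.lcos_mult_one IA.subset bquot_def)

text \<open>The condition consists only of equalities of cosets of \<open>I\<close>, so it persists
  when \<open>I\<close> is replaced by a larger ideal.\<close>

lemma proj_mem_soc_iff:
  assumes "a \<in> bcar B"
  shows "proj a \<in> bsoc (bquot B I) \<longleftrightarrow>
    (\<forall>b\<in>bcar B. proj (a \<boxdot> b) = proj (a \<boxplus> b) \<and> proj (a \<boxplus> b) = proj (b \<boxplus> a))"
  using assms by (simp add: Q.soc_iff bcar_quot proj_simps)

text \<open>Applied to the socle of the quotient, this is the step from one term of the socle series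
  to the next.\<close>

lemma is_ideal_preimage:
  assumes J: "is_ideal (bquot B I) J"
  shows "is_ideal B {x \<in> bcar B. proj x \<in> J}"
proof -
  interpret JA: normal J "addG (bquot B I)"
    using J by (simp add: is_ideal_def)
  interpret JM: normal J "mulG (bquot B I)"
    using J by (simp add: is_ideal_def)
  show ?thesis
  proof (rule is_idealI; (elim CollectE conjE)?)
    show "\<nought> \<in> {x \<in> bcar B. proj x \<in> J}"
      using JA.one_closed by (simp add: zero_quot)
    fix a assume a: "a \<in> bcar B" "proj a \<in> J"
    show "\<boxminus> a \<in> {x \<in> bcar B. proj x \<in> J}"
      using a JA.m_inv_closed[of "proj a"] by (simp add: Q.m_inv_addG neg_quot)
    fix b assume b: "b \<in> bcar B"
    then have pb: "proj b \<in> bcar (bquot B I)"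
      by (simp add: bcar_quot)
    show "b \<boxplus> a \<boxplus> \<boxminus> b \<in> {x \<in> bcar B. proj x \<in> J}"
      using a b JA.inv_op_closed2[of "proj b" "proj a"] pb by (simp add: Q.m_inv_addG proj_simps)
    show "b \<boxdot> a \<boxdot> recip b \<in> {x \<in> bcar B. proj x \<in> J}"
      using a b JM.inv_op_closed2[of "proj b" "proj a"] pb by (simp add: proj_simps)
    have "blambda (bquot B I) (proj b) (proj a) \<in> J"
      using J a pb by (auto simp: is_ideal_def)
    then show "lam b a \<in> {x \<in> bcar B. proj x \<in> J}"
      using a b by (simp add: proj_simps)
  next
    fix a b assume "a \<in> bcar B" "proj a \<in> J" "b \<in> bcar B" "proj b \<in> J"
    then show "a \<boxplus> b \<in> {x \<in> bcar B. proj x \<in> J}"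
      using JA.m_closed[of "proj a" "proj b"] by (simp add: proj_simps)
  qed auto
qed

text \<open>This makes a factor of an ideal chain an ideal of the quotient, where the result on
  prime order applies.\<close>

lemma is_ideal_image:
  assumes K: "is_ideal B K"
  shows "is_ideal (bquot B I) (proj ` K)"
proof -
  interpret K: brace_ideal B K
    by unfold_locales (rule K)
  note [simp] = K.IA.mem_carrier
  show ?thesis
  proof (rule Q.is_idealI)
    show "proj ` K \<subseteq> bcar (bquot B I)"
      by (auto simp: bcar_quot)
    show "bzero (bquot B I) \<in> proj ` K"
      by (simp add: zero_quot)
  next
    fix u v assume "u \<in> proj ` K" "v \<in> proj ` K"
    then show "badd (bquot B I) u v \<in> proj ` K"
      by (auto simp: proj_simps)
  next
    fix u assume "u \<in> proj ` K"
    then show "bneg (bquot B I) u \<in> proj ` K"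
      by (auto simp: proj_simps)
  next
    fix u v assume "u \<in> proj ` K" "v \<in> bcar (bquot B I)"
    then obtain a b where "a \<in> K" "u = proj a" "b \<in> bcar B" "v = proj b"
      by (auto simp: bcar_quot)
    then show "badd (bquot B I) (badd (bquot B I) v u) (bneg (bquot B I) v) \<in> proj ` K"
      "blambda (bquot B I) v u \<in> proj ` K"
      "bmul (bquot B I) (bmul (bquot B I) v u) (m_inv (mulG (bquot B I)) v) \<in> proj ` K"
      by (simp_all add: proj_simps K.IA.inv_op_closed2 K.IM.inv_op_closed2 K.lam_ideal)
  qed
qed

end

section \<open>The socle series compared with the lower central series and with ideal chains\<close>

context brace
begin

lemma is_ideal_zero: "is_ideal B {\<nought>}"
  by (rule is_idealI) auto

lemma is_ideal_soc_series: "is_ideal B (soc_series B k)"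
proof (induction k)
  case 0
  show ?case by (simp add: is_ideal_zero)
next
  case (Suc k)
  interpret brace_ideal B "soc_series B k"
    by unfold_locales (rule Suc)
  show ?case
    using is_ideal_preimage[OF Q.is_ideal_soc] by simp
qed

text \<open>The factor of consecutive socle terms is additively central in the quotient, so forming
  commutators with a socle term lands one term lower.\<close>

lemma lower_central_subset_soc_series:
  assumes "soc_series B n = bcar B" "k \<le> n"
  shows "lower_central (addG B) k \<subseteq> soc_series B (n - k)"
  using assms(2)
proof (induction k)
  case 0
  then show ?case using assms(1) by simp
next
  case (Suc k)
  interpret brace_ideal B "soc_series B (n - Suc k)"
    by unfold_locales (rule is_ideal_soc_series)
  \<comment> \<open>The bound \<open>Suc k \<le> n\<close> keeps the truncated subtraction exact, so
    the definition of \<open>soc_series\<close> at a successor applies.\<close>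
  have eq: "n - k = Suc (n - Suc k)"
    using Suc by simp
  have "g \<boxplus> x \<boxplus> \<boxminus> g \<boxplus> \<boxminus> x \<in> soc_series B (n - Suc k)"
    if g: "g \<in> bcar B" and x: "x \<in> lower_central (addG B) k" for g x
  proof -
    have x': "x \<in> bcar B" "proj x \<in> bsoc (bquot B (soc_series B (n - Suc k)))"
      using Suc x unfolding eq by auto
    then have "\<forall>b\<in>bcar B. proj (x \<boxplus> b) = proj (b \<boxplus> x)"
      by (simp add: proj_mem_soc_iff)
    from bspec[OF this g]
    have "\<boxminus> (x \<boxplus> g) \<boxplus> (g \<boxplus> x) \<in> soc_series B (n - Suc k)"
      using g x' by (simp add: proj_eq_iff)
    \<comment> \<open>This is the commutator of the inverses; conjugation by \<open>x + g\<close> turns it into that of \<open>g\<close> and \<open>x\<close>.\<close>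
    from IA.inv_op_closed2[OF _ this, of "x \<boxplus> g"] show ?thesis
      using g x' by (simp add: A.inv_mult_group A.m_assoc)
  qed
  then have "generate (addG B) {g \<boxplus> x \<boxplus> \<boxminus> g \<boxplus> \<boxminus> x | g x.
      g \<in> bcar B \<and> x \<in> lower_central (addG B) k} \<subseteq> soc_series B (n - Suc k)"
    by (intro A.generate_subgroup_incl IA.subgroup_axioms) blast
  then show ?case
    by (simp add: m_inv_addG)
qed

text \<open>Each factor lies in the socle of B/I_k, by hypothesis if it is infinite cyclic and by
  \<open>prime_ideal_subset_soc\<close> if its order is prime. The induction hypothesis then moves
  this from B/I_k to B/Soc_k.\<close>

lemma ideal_chain_subset_soc_series:
  assumes nil: "nilpotent_group (addG B)"
    and I0: "I 0 = {bzero B}"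
    and ideal: "\<forall>i\<le>n. is_ideal B (I i)"
    and fac: "\<forall>i<n. let Q = bquot B (I i); J = (\<lambda>a. a <#\<^bsub>addG B\<^esub> I i) ` I (Suc i) in
          (infinite J \<and> (\<exists>g\<in>J. J = range (\<lambda>k::int. g [^]\<^bsub>addG Q\<^esub> k)) \<and> J \<subseteq> bsoc Q)
          \<or> Factorial_Ring.prime (card J)"
    and "k \<le> n"
  shows "I k \<subseteq> soc_series B k"
  using \<open>k \<le> n\<close>
proof (induction k)
  case 0
  then show ?case using I0 by simp
next
  case (Suc k)
  interpret I: brace_ideal B "I k"
    using Suc ideal by unfold_locales auto
  interpret S: brace_ideal B "soc_series B k"
    by unfold_locales (rule is_ideal_soc_series)
  have K: "is_ideal B (I (Suc k))"
    using Suc ideal by blast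
  then have sub: "I (Suc k) \<subseteq> bcar B"
    using subgroup.subset[of "I (Suc k)" "addG B"] by (simp add: is_ideal_def)
  \<comment> \<open>The prime order case is applied in this quotient, which inherits nilpotency
    along the surjective projection.\<close>
  have "nilpotent_group (addG (bquot B (I k)))"
    by (rule group_hom.nilpotent_image[OF I.group_hom_add _ nil]) (simp add: I.bcar_quot)
  then have "I.proj ` I (Suc k) \<subseteq> bsoc (bquot B (I k))"
    using fac[rule_format, of k] Suc.prems I.Q.prime_ideal_subset_soc[OF _ I.is_ideal_image[OF K]]
    by (auto simp: Let_def)
  then have soc: "I.proj x \<in> bsoc (bquot B (I k))" if "x \<in> I (Suc k)" for x
    using that by blast
  \<comment> \<open>By induction I_k is contained in Soc_k, so congruence modulo I_k implies
    congruence modulo Soc_k.\<close>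
  have coarser: "S.proj a = S.proj b"
    if "I.proj a = I.proj b" "a \<in> bcar B" "b \<in> bcar B" for a b
    using that Suc by (auto simp: I.proj_eq_iff S.proj_eq_iff)
  show ?case
  proof
    fix x assume x: "x \<in> I (Suc k)"
    then have x': "x \<in> bcar B"
      using sub by blast
    have "S.proj (x \<boxdot> b) = S.proj (x \<boxplus> b) \<and> S.proj (x \<boxplus> b) = S.proj (b \<boxplus> x)"
      if b: "b \<in> bcar B" for b
    proof (intro conjI coarser)
      show "I.proj (x \<boxdot> b) = I.proj (x \<boxplus> b)" "I.proj (x \<boxplus> b) = I.proj (b \<boxplus> x)"
        using soc[OF x] b unfolding I.proj_mem_soc_iff[OF x'] by blast+
    qed (use x' b in simp_all)
    then show "x \<in> soc_series B (Suc k)"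
      using x' by (simp add: S.proj_mem_soc_iff)
  qed
qed

end

theorem theorem3p27:
  fixes B :: "'a brace"
  assumes "is_brace B" and "supersoluble B"
  shows "nilpotent_group (addG B) \<longleftrightarrow> (\<exists>n::nat. soc_series B n = bcar B)"
proof
  interpret brace B
    by unfold_locales fact
  show "\<exists>n. soc_series B n = bcar B" if "nilpotent_group (addG B)"
  proof -
    obtain n and I :: "nat \<Rightarrow> 'a set" where "I 0 = {bzero B}" "I n = bcar B"
      and "\<forall>i\<le>n. is_ideal B (I i)"
      and "\<forall>i<n. let Q = bquot B (I i); J = (\<lambda>a. a <#\<^bsub>addG B\<^esub> I i) ` I (Suc i) in
          (infinite J \<and> (\<exists>g\<in>J. J = range (\<lambda>k::int. g [^]\<^bsub>addG Q\<^esub> k)) \<and> J \<subseteq> bsoc Q)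
          \<or> Factorial_Ring.prime (card J)"
      using assms(2) unfolding supersoluble_def by blast
    with ideal_chain_subset_soc_series[OF that, of I n n] have "bcar B \<subseteq> soc_series B n"
      by simp
    moreover have "soc_series B n \<subseteq> bcar B"
      by (cases n) auto
    ultimately show ?thesis
      by blast
  qed
  show "nilpotent_group (addG B)" if "\<exists>n. soc_series B n = bcar B"
  proof -
    from that obtain n where n: "soc_series B n = bcar B" ..
    have "lower_central (addG B) n \<subseteq> {bzero B}"
      \<comment> \<open>With \<open>k = n\<close> the bound becomes \<open>soc_series B 0\<close>,
        the zero ideal.\<close>
      using lower_central_subset_soc_series[OF n order_refl] by simp
    moreover have "bzero B \<in> lower_central (addG B) n"
      using generate.one[of "addG B"] by (cases n) auto
    ultimately show ?thesis
      by (auto simp: nilpotent_group_def)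
  qed
qed

end
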